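(* Consider a finite-horizon constrained MDP with occupancy-measure set $\Delta(\mathcal M)$, reward vector $r$, constraint functions $g_1,\dots,g_m$, true thresholds $\alpha\in[0,H]^m$ and optimistic thresholds $\underline\alpha\in\mathbb R^m$, $\underline\alpha_i\le\alpha_i$ for all $i\in[m]$. Assume there exist a policy $\pi^0$ and $\xi\in\mathbb R_{>0}^m$ such that $V_{g_i}^{\pi^0}\ge\alpha_i+\xi_i$ for all $i\in[m]$. Then $$\min_{\lambda\in\mathbb R_{\ge0}^m}\ \max_{q\in\mathcal F_{\mathrm{opt}}}\mathcal L(q,\lambda)=\max_{q\in\mathcal F_{\mathrm{opt}}}\ \min_{\lambda\in\mathbb R_{\ge0}^m}\mathcal L(q,\lambda).$$
   Context: $\mathcal S,\mathcal A$ are finite state and action sets, $H$ the horizon, $p_h(\cdot\mid s,a)$ the transition probabilities, $s_1$ a fixed initial state. A policy is $\pi=(\pi_1,\dots,\pi_H)$ with $\pi_h(\cdot\mid s)$ a probability distribution on $\mathcal A$. Rewards and constraint functions satisfy $r_h(s,a),g_{i,h}(s,a)\in[0,1]$, and $V_v^\pi=\mathbb E_{\pi,p}[\sum_{h=1}^Hv_h(s_h,a_h)\mid s_1]$. The occupancy measure of $\pi$ is $q_h^\pi(s,a;p)=\mathbb P(s_h=s,a_h=a\mid p,\pi)$, and $\Delta(\mathcal M)\subset\mathbb R^{H\times\mathcal S\times\mathcal A}$ is the set of all occupancy measures of policies, so that $V_r^\pi=r^\top q^\pi$ and $(V_{g_i}^\pi)_{i\in[m]}=G^\top q^\pi$ with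 $G$ the matrix whose $i$-th constraint vector is $(g_{i,h}(s,a))_{h,s,a}$. Define $$\mathcal L(q,\lambda)=r^\top q+\lambda^\top(G^\top q-\alpha),\qquad \mathcal F_{\mathrm{opt}}=\Big\{q\in\Delta(\mathcal M):\ \sum_{h,s,a}q_h(s,a)g_{i,h}(s,a)\ge\underline\alpha_i\ \ \forall i\in[m]\Big\}.$$ The optimistic threshold $\underline\alpha$ is a lower confidence bound for $\alpha$. For $q\in\mathcal F_{\mathrm{opt}}$ with $G^\top q\not\ge\alpha$ the inner minimum over $\lambda$ is understood as $-\infty$. *)

theory Defs
  imports "HOL-Probability.Probability"
begin

text \<open>
  Time steps are \<open>1, \<dots>, H\<close>. A transition kernel is \<open>p h s a :: 's pmf\<close>, a (Markov) policy is
  \<open>\<pi> h s :: 'a pmf\<close>; what they do outside \<open>{1..H}\<close> is irrelevant.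
\<close>

type_synonym ('s, 'a) kernel = "nat \<Rightarrow> 's \<Rightarrow> 'a \<Rightarrow> 's pmf"
type_synonym ('s, 'a) policy = "nat \<Rightarrow> 's \<Rightarrow> 'a pmf"
type_synonym ('s, 'a) hsa = "nat \<Rightarrow> 's \<Rightarrow> 'a \<Rightarrow> real"

text \<open>
  Joint law of the first \<open>n\<close> state-action pairs, in chronological order, and the state
  reached after them.
\<close>

primrec run :: "('s, 'a) kernel \<Rightarrow> 's \<Rightarrow> ('s, 'a) policy \<Rightarrow> nat \<Rightarrow> (('s \<times> 'a) list \<times> 's) pmf" where
  "run p s1 \<pi> 0 = return_pmf ([], s1)"
| "run p s1 \<pi> (Suc n) =
     bind_pmf (run p s1 \<pi> n) (\<lambda>(\<tau>, s).
       bind_pmf (\<pi> (Suc n) s) (\<lambda>a.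
         map_pmf (\<lambda>s'. (\<tau> @ [(s, a)], s')) (p (Suc n) s a)))"

definition trajectory :: "('s, 'a) kernel \<Rightarrow> 's \<Rightarrow> nat \<Rightarrow> ('s, 'a) policy \<Rightarrow> ('s \<times> 'a) list pmf" where
  "trajectory p s1 H \<pi> = map_pmf fst (run p s1 \<pi> H)"

text \<open>The pair \<open>(s\<^sub>h, a\<^sub>h)\<close> is the list entry at position \<open>h - 1\<close>.\<close>

definition policy_value :: "('s, 'a) kernel \<Rightarrow> 's \<Rightarrow> nat \<Rightarrow> ('s, 'a) hsa \<Rightarrow> ('s, 'a) policy \<Rightarrow> real" where
  "policy_value p s1 H v \<pi> =
     measure_pmf.expectation (trajectory p s1 H \<pi>)
       (\<lambda>\<tau>. \<Sum>h = 1..H. v h (fst (\<tau> ! (h - 1))) (snd (\<tau> ! (h - 1))))"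

text \<open>
  Elements of \<open>\<real>\<^bsup>H\<times>S\<times>A\<^esup>\<close> are functions \<open>q h s a\<close> that vanish for \<open>h\<close> outside \<open>{1..H}\<close>.
\<close>

definition occupancy :: "('s, 'a) kernel \<Rightarrow> 's \<Rightarrow> nat \<Rightarrow> ('s, 'a) policy \<Rightarrow> ('s, 'a) hsa" where
  "occupancy p s1 H \<pi> h s a =
     (if h \<in> {1..H}
      then measure_pmf.prob (trajectory p s1 H \<pi>) {\<tau>. \<tau> ! (h - 1) = (s, a)}
      else 0)"

definition occupancies :: "('s, 'a) kernel \<Rightarrow> 's \<Rightarrow> nat \<Rightarrow> ('s, 'a) hsa set" where
  "occupancies p s1 H = range (occupancy p s1 H)"

definition pairing :: "nat \<Rightarrow> ('s::finite, 'a::finite) hsa \<Rightarrow> ('s, 'a) hsa \<Rightarrow> real" where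
  "pairing H v q = (\<Sum>h = 1..H. \<Sum>s\<in>UNIV. \<Sum>a\<in>UNIV. v h s a * q h s a)"

text \<open>The vector \<open>G\<^sup>T q\<close>.\<close>

definition constraint_vec ::
    "nat \<Rightarrow> ('m::finite \<Rightarrow> ('s::finite, 'a::finite) hsa) \<Rightarrow> ('s, 'a) hsa \<Rightarrow> real ^ 'm" where
  "constraint_vec H g q = (\<chi> i. pairing H (g i) q)"

definition Lagrangian ::
    "nat \<Rightarrow> ('s::finite, 'a::finite) hsa \<Rightarrow> ('m::finite \<Rightarrow> ('s, 'a) hsa) \<Rightarrow> real ^ 'm
      \<Rightarrow> ('s, 'a) hsa \<Rightarrow> real ^ 'm \<Rightarrow> real" where
  "Lagrangian H r g \<alpha> q l = pairing H r q + l \<bullet> (constraint_vec H g q - \<alpha>)"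

definition F_opt ::
    "('s::finite, 'a::finite) kernel \<Rightarrow> 's \<Rightarrow> nat \<Rightarrow> ('m::finite \<Rightarrow> ('s, 'a) hsa) \<Rightarrow> real ^ 'm
      \<Rightarrow> ('s, 'a) hsa set" where
  "F_opt p s1 H g \<alpha>_low =
     {q \<in> occupancies p s1 H. \<forall>i. pairing H (g i) q \<ge> \<alpha>_low $ i}"

definition nonneg_vecs :: "(real ^ 'm) set" where
  "nonneg_vecs = {l. \<forall>i. 0 \<le> l $ i}"

lemma length_run: "(\<tau>, s) \<in> set_pmf (run p s1 \<pi> n) \<Longrightarrow> length \<tau> = n"
  by (induction n arbitrary: \<tau> s) fastforce+

lemma finite_set_run:
  fixes p :: "('s::finite, 'a::finite) kernel"
  shows "finite (set_pmf (run p s1 \<pi> n))"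
  by (induction n) auto

lemma policy_value_eq_pairing:
  fixes p :: "('s::finite, 'a::finite) kernel"
  shows "policy_value p s1 H v \<pi> = pairing H v (occupancy p s1 H \<pi>)"
proof -
  let ?T = "trajectory p s1 H \<pi>"
  have fin: "finite (set_pmf ?T)"
    by (simp add: trajectory_def finite_set_run)
  have int: "integrable (measure_pmf ?T) f" for f :: "('s \<times> 'a) list \<Rightarrow> real"
    by (rule integrable_measure_pmf_finite[OF fin])
  have step: "measure_pmf.expectation ?T (\<lambda>\<tau>. v h (fst (\<tau> ! (h - 1))) (snd (\<tau> ! (h - 1))))
      = (\<Sum>s\<in>UNIV. \<Sum>a\<in>UNIV. v h s a * occupancy p s1 H \<pi> h s a)" if h: "h \<in> {1..H}" for h
  proof -
    have "measure_pmf.expectation ?T (\<lambda>\<tau>. v h (fst (\<tau> ! (h - 1))) (snd (\<tau> ! (h - 1))))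
        = measure_pmf.expectation (map_pmf (\<lambda>\<tau>. \<tau> ! (h - 1)) ?T) (\<lambda>x. v h (fst x) (snd x))"
      by simp
    also have "\<dots> = (\<Sum>x\<in>UNIV. v h (fst x) (snd x) * pmf (map_pmf (\<lambda>\<tau>. \<tau> ! (h - 1)) ?T) x)"
      by (subst integral_measure_pmf[of UNIV]) (auto simp: mult.commute)
    also have "\<dots> = (\<Sum>x\<in>UNIV. v h (fst x) (snd x) * occupancy p s1 H \<pi> h (fst x) (snd x))"
      using h by (intro sum.cong) (auto simp: pmf_map occupancy_def vimage_def)
    finally show ?thesis
      by (simp add: sum.cartesian_product case_prod_beta flip: UNIV_Times_UNIV)
  qed
  show ?thesis
    unfolding policy_value_def pairing_def
    by (subst Bochner_Integration.integral_sum) (use int step in \<open>auto intro!: sum.cong\<close>)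
qed

end

theory Submission
  imports Defs
begin

text \<open>
  The occupancy measures are exactly the solutions of the flow equations, because a flow is
  realised by the policy obtained by normalising it at every state. Hence they form a convex
  compact set, and so does \<open>F_opt\<close>. Let \<open>M\<close> be the largest reward of an \<open>\<alpha>\<close>-feasible
  element. The convex set of pairs \<open>(r\<^sup>T q, G\<^sup>T q)\<close> is disjoint from \<open>{(x, y). x > M \<and> y \<ge> \<alpha>}\<close>,
  and a separating hyperplane has a nonnegative normal \<open>(\<mu>, l)\<close>. The strictly feasible policy
  excludes \<open>\<mu> = 0\<close>, so \<open>l / \<mu>\<close> is a multiplier whose dual value is \<open>M\<close>.
\<close>

section \<open>Occupancy measures as solutions of the flow equations\<close>

text \<open>The bounds are phrased as membership in a set depending on \<open>h\<close>, so that
  they cut out a product of compact convex factors, with factor \<open>{0}\<close> outside the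
  horizon. The guard \<open>0 < H\<close> covers the empty horizon, where the only occupancy measure
  is zero and carries no initial mass.\<close>

definition flows :: "('s::finite, 'a::finite) kernel \<Rightarrow> 's \<Rightarrow> nat \<Rightarrow> ('s, 'a) hsa set" where
  "flows p s1 H = {q. (\<forall>h s a. q h s a \<in> (if h \<in> {1..H} then {0..1} else {0}))
    \<and> (\<forall>s. 0 < H \<longrightarrow> (\<Sum>a\<in>UNIV. q 1 s a) = indicator {s1} s)
    \<and> (\<forall>n s'. 0 < n \<and> n < H \<longrightarrow>
        (\<Sum>a\<in>UNIV. q (Suc n) s' a) = (\<Sum>s\<in>UNIV. \<Sum>a\<in>UNIV. q n s a * pmf (p n s a) s'))}"

text \<open>Index shift: the state reached after \<open>n\<close> steps is the one in which action
  number \<open>Suc n\<close> is chosen, so \<open>state_law\<close> at \<open>n\<close> goes with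
  \<open>\<pi> (Suc n)\<close> and with \<open>q (Suc n)\<close>.\<close>

definition state_law :: "('s, 'a) kernel \<Rightarrow> 's \<Rightarrow> ('s, 'a) policy \<Rightarrow> nat \<Rightarrow> 's pmf" where
  "state_law p s1 \<pi> n = map_pmf snd (run p s1 \<pi> n)"

lemma state_law_0: "state_law p s1 \<pi> 0 = return_pmf s1"
  by (simp add: state_law_def)

lemma state_law_Suc:
  "state_law p s1 \<pi> (Suc n) =
     bind_pmf (state_law p s1 \<pi> n) (\<lambda>s. bind_pmf (\<pi> (Suc n) s) (p (Suc n) s))"
  by (simp add: state_law_def map_bind_pmf bind_map_pmf map_pmf_comp case_prod_beta)

lemma pmf_state_law_Suc:
  fixes p :: "('s::finite, 'a::finite) kernel"
  shows "pmf (state_law p s1 \<pi> (Suc n)) s' =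
     (\<Sum>s\<in>UNIV. \<Sum>a\<in>UNIV. pmf (state_law p s1 \<pi> n) s * pmf (\<pi> (Suc n) s) a * pmf (p (Suc n) s a) s')"
  by (simp add: state_law_Suc pmf_bind integral_measure_pmf[of UNIV] sum_distrib_left mult.assoc)

text \<open>Histories grow at the end, so a further step keeps the earlier entries; the newly drawn
  action and state no longer influence the result and integrate out.\<close>

lemma map_nth_run_Suc:
  assumes "k < n"
  shows "map_pmf (\<lambda>x. fst x ! k) (run p s1 \<pi> (Suc n)) = map_pmf (\<lambda>x. fst x ! k) (run p s1 \<pi> n)"
proof -
  have "map_pmf (\<lambda>x. fst x ! k) (run p s1 \<pi> (Suc n)) =
      bind_pmf (run p s1 \<pi> n) (\<lambda>x. bind_pmf (\<pi> (Suc n) (snd x)) (\<lambda>a.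
        map_pmf (\<lambda>s'. (fst x @ [(snd x, a)]) ! k) (p (Suc n) (snd x) a)))"
    by (simp add: map_bind_pmf map_pmf_comp case_prod_beta)
  also have "\<dots> = bind_pmf (run p s1 \<pi> n) (\<lambda>x. return_pmf (fst x ! k))"
    using assms by (intro bind_pmf_cong refl) (auto dest!: length_run simp: nth_append)
  finally show ?thesis
    by (simp add: map_pmf_def)
qed

text \<open>By \<open>length_run\<close> the entry at position \<open>n\<close> is the pair just
  appended, and the successor state drawn after it integrates out.\<close>

lemma map_nth_run_last:
  "map_pmf (\<lambda>x. fst x ! n) (run p s1 \<pi> (Suc n)) =
     bind_pmf (state_law p s1 \<pi> n) (\<lambda>s. map_pmf (Pair s) (\<pi> (Suc n) s))"
proof -
  have "map_pmf (\<lambda>x. fst x ! n) (run p s1 \<pi> (Suc n)) =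
      bind_pmf (run p s1 \<pi> n) (\<lambda>x. bind_pmf (\<pi> (Suc n) (snd x)) (\<lambda>a.
        map_pmf (\<lambda>s'. (fst x @ [(snd x, a)]) ! n) (p (Suc n) (snd x) a)))"
    by (simp add: map_bind_pmf map_pmf_comp case_prod_beta)
  also have "\<dots> = bind_pmf (run p s1 \<pi> n) (\<lambda>x. map_pmf (Pair (snd x)) (\<pi> (Suc n) (snd x)))"
    unfolding map_pmf_def[of "Pair _"]
    by (intro bind_pmf_cong refl) (auto dest!: length_run simp: nth_append)
  finally show ?thesis
    by (simp add: state_law_def bind_map_pmf)
qed

lemma map_nth_trajectory:
  assumes "n < H"
  shows "map_pmf (\<lambda>\<tau>. \<tau> ! n) (trajectory p s1 H \<pi>) =
     bind_pmf (state_law p s1 \<pi> n) (\<lambda>s. map_pmf (Pair s) (\<pi> (Suc n) s))"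
proof -
  from assms have "Suc n \<le> H" by simp
  then have "map_pmf (\<lambda>x. fst x ! n) (run p s1 \<pi> H) =
     bind_pmf (state_law p s1 \<pi> n) (\<lambda>s. map_pmf (Pair s) (\<pi> (Suc n) s))"
    \<comment> \<open>The induction starts at horizon \<open>Suc n\<close>, where the entry is
      written, and longer horizons leave it unchanged.\<close>
    by (induction H rule: dec_induct) (simp_all only: map_nth_run_last map_nth_run_Suc Suc_le_eq)
  then show ?thesis
    by (simp add: trajectory_def map_pmf_comp)
qed

lemma occupancy_Suc:
  fixes p :: "('s::finite, 'a::finite) kernel"
  assumes "n < H"
  shows "occupancy p s1 H \<pi> (Suc n) s a = pmf (state_law p s1 \<pi> n) s * pmf (\<pi> (Suc n) s) a"
proof -
  have "occupancy p s1 H \<pi> (Suc n) s a = pmf (map_pmf (\<lambda>\<tau>. \<tau> ! n) (trajectory p s1 H \<pi>)) (s, a)"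
    using assms by (simp add: occupancy_def pmf_map vimage_def)
  also have "\<dots> = (\<Sum>s'\<in>UNIV. pmf (state_law p s1 \<pi> n) s' * pmf (map_pmf (Pair s') (\<pi> (Suc n) s')) (s, a))"
    using assms by (simp add: map_nth_trajectory pmf_bind integral_measure_pmf[of UNIV])
  also have "\<dots> = (\<Sum>s'\<in>UNIV. if s' = s then pmf (state_law p s1 \<pi> n) s * pmf (\<pi> (Suc n) s) a else 0)"
  proof (intro sum.cong refl)
    fix s'
    \<comment> \<open>\<open>Pair s'\<close> yields only pairs with first component
      \<open>s'\<close>, so a single summand survives; injectivity of \<open>Pair s\<close> gives
      its value.\<close>
    have "pmf (map_pmf (Pair s') (\<pi> (Suc n) s')) (s, a) = (if s' = s then pmf (\<pi> (Suc n) s) a else 0)"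
      using pmf_map_inj'[of "Pair s" "\<pi> (Suc n) s" a]
      by (auto simp: pmf_eq_0_set_pmf inj_on_def)
    then show "pmf (state_law p s1 \<pi> n) s' * pmf (map_pmf (Pair s') (\<pi> (Suc n) s')) (s, a) =
        (if s' = s then pmf (state_law p s1 \<pi> n) s * pmf (\<pi> (Suc n) s) a else 0)"
      by simp
  qed
  finally show ?thesis by simp
qed

lemma sum_pmf_UNIV: "(\<Sum>a\<in>UNIV. pmf P (a :: 'a::finite)) = 1"
  by (simp add: sum_pmf_eq_1)

text \<open>By \<open>occupancy_Suc\<close>, summing out the action leaves the state law, and the
  one-step recursion of the state law is the flow equation.\<close>

lemma occupancy_in_flows:
  fixes p :: "('s::finite, 'a::finite) kernel"
  shows "occupancy p s1 H \<pi> \<in> flows p s1 H"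
proof -
  have marginal: "(\<Sum>a\<in>UNIV. occupancy p s1 H \<pi> (Suc n) s a) = pmf (state_law p s1 \<pi> n) s"
    if "n < H" for n s
    using that by (simp add: occupancy_Suc sum_pmf_UNIV flip: sum_distrib_left)
  have "(\<Sum>a\<in>UNIV. occupancy p s1 H \<pi> (Suc n) s' a) =
      (\<Sum>s\<in>UNIV. \<Sum>a\<in>UNIV. occupancy p s1 H \<pi> n s a * pmf (p n s a) s')"
    if n: "0 < n" "n < H" for n s'
  proof -
    obtain k where k: "n = Suc k" using n gr0_implies_Suc by blast
    have "pmf (state_law p s1 \<pi> n) s' =
      (\<Sum>s\<in>UNIV. \<Sum>a\<in>UNIV. occupancy p s1 H \<pi> n s a * pmf (p n s a) s')"
      using n by (simp add: k pmf_state_law_Suc occupancy_Suc)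
    then show ?thesis using marginal n by simp
  qed
  moreover have "(\<Sum>a\<in>UNIV. occupancy p s1 H \<pi> 1 s a) = indicator {s1} s" if "0 < H" for s
    using marginal[OF that, of s] by (simp add: state_law_0 indicator_def)
  moreover have "occupancy p s1 H \<pi> h s a \<in> (if h \<in> {1..H} then {0..1} else {0})" for h s a
    by (simp add: occupancy_def)
  ultimately show ?thesis by (simp add: flows_def)
qed

text \<open>The multiplicative form avoids dividing by zero: at a state with no mass every
  distribution qualifies, which lets the policy be arbitrary at unvisited states.\<close>

lemma ex_pmf_proportional:
  fixes f :: "'a::finite \<Rightarrow> real"
  assumes "\<And>a. 0 \<le> f a"
  shows "\<exists>P. \<forall>a. f a = (\<Sum>a\<in>UNIV. f a) * pmf P a"
proof (cases "(\<Sum>a\<in>UNIV. f a) = 0")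
  case True
  with assms show ?thesis by (simp add: sum_nonneg_eq_0_iff)
next
  case False
  let ?c = "\<Sum>a\<in>UNIV. f a"
  have "?c \<ge> 0" using assms by (intro sum_nonneg) auto
  with False have pos: "?c > 0" by simp
  have "(\<integral>\<^sup>+ a. ennreal (f a / ?c) \<partial>count_space UNIV) = 1"
    using assms pos
    by (simp add: nn_integral_count_space_finite sum_ennreal flip: sum_divide_distrib)
  then have "pmf (embed_pmf (\<lambda>a. f a / ?c)) a = f a / ?c" for a
    using assms pos by (intro pmf_embed_pmf) auto
  then show ?thesis using False by (intro exI[of _ "embed_pmf (\<lambda>a. f a / ?c)"]) simp
qed

lemma flows_subset_occupancies:
  fixes p :: "('s::finite, 'a::finite) kernel"
  assumes "q \<in> flows p s1 H"
  shows "q \<in> occupancies p s1 H"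
proof -
  have q0: "q h s a = 0" if "h \<notin> {1..H}" for h s a
    using assms that by (auto simp: flows_def split: if_splits)
  have nonneg: "0 \<le> q h s a" for h s a
    using assms q0[of h s a] unfolding flows_def
    by (cases "h \<in> {1..H}") (auto split: if_splits)
  have init: "(\<Sum>a\<in>UNIV. q 1 s a) = indicator {s1} s" if "0 < H" for s
    using assms that by (auto simp: flows_def)
  have flow: "(\<Sum>a\<in>UNIV. q (Suc n) s' a) = (\<Sum>s\<in>UNIV. \<Sum>a\<in>UNIV. q n s a * pmf (p n s a) s')"
    if "0 < n" "n < H" for n s'
    using assms that by (auto simp: flows_def)
  have "\<exists>P. \<forall>a. q h s a = (\<Sum>a\<in>UNIV. q h s a) * pmf P a" for h s
    using nonneg by (rule ex_pmf_proportional)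
  then obtain \<pi> where \<pi>: "\<And>h s a. q h s a = (\<Sum>a\<in>UNIV. q h s a) * pmf (\<pi> h s) a"
    by metis
  \<comment> \<open>Both sides start from the point mass at \<open>s1\<close> and obey the same
    recursion, because \<open>q\<close> factors as its state marginal times
    \<open>\<pi>\<close>.\<close>
  have law: "pmf (state_law p s1 \<pi> n) s = (\<Sum>a\<in>UNIV. q (Suc n) s a)" if "n < H" for n s
    using that
  proof (induction n arbitrary: s)
    case 0
    then show ?case using init[of s] by (simp add: state_law_0 indicator_def)
  next
    case (Suc n)
    then have "pmf (state_law p s1 \<pi> (Suc n)) s =
        (\<Sum>s'\<in>UNIV. \<Sum>a\<in>UNIV. q (Suc n) s' a * pmf (p (Suc n) s' a) s)"
      by (simp add: pmf_state_law_Suc \<pi>[symmetric])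
    also have "\<dots> = (\<Sum>a\<in>UNIV. q (Suc (Suc n)) s a)"
      using Suc.prems by (simp only: flow zero_less_Suc)
    finally show ?case .
  qed
  have "occupancy p s1 H \<pi> h s a = q h s a" for h s a
  proof (cases "h \<in> {1..H}")
    case True
    then obtain n where "h = Suc n" "n < H" by (cases h) auto
    then show ?thesis by (simp add: occupancy_Suc law \<pi>[symmetric])
  next
    case False
    then show ?thesis by (auto simp: occupancy_def q0)
  qed
  then have "q = occupancy p s1 H \<pi>" by (intro ext) simp
  then show ?thesis by (simp add: occupancies_def)
qed

lemma occupancies_eq_flows:
  fixes p :: "('s::finite, 'a::finite) kernel"
  shows "occupancies p s1 H = flows p s1 H"
proof
  show "occupancies p s1 H \<subseteq> flows p s1 H"
    unfolding occupancies_def by (intro image_subsetI occupancy_in_flows)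
  show "flows p s1 H \<subseteq> occupancies p s1 H"
    by (intro subsetI flows_subset_occupancies)
qed

section \<open>Convexity and compactness of the set of flows\<close>

lemma flows_convex:
  assumes "q1 \<in> flows p s1 H" "q2 \<in> flows p s1 H" "0 \<le> u" "0 \<le> v" "u + v = 1"
  shows "(\<lambda>h s a. u * q1 h s a + v * q2 h s a) \<in> flows p s1 H"
proof -
  have v: "v = 1 - u" using assms by simp
  have "u * q1 h s a + v * q2 h s a \<in> (if h \<in> {1..H} then {0..1} else {0})" for h s a
  proof -
    have "convex (if h \<in> {1..H} then {0..1} else {0 :: real})" by simp
    moreover have "q1 h s a \<in> (if h \<in> {1..H} then {0..1} else {0})"
      "q2 h s a \<in> (if h \<in> {1..H} then {0..1} else {0})"
      using assms by (auto simp only: flows_def mem_Collect_eq)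
    ultimately show ?thesis
      using assms(3-5) unfolding convex_def real_scaleR_def by blast
  qed
  moreover have "(\<Sum>a\<in>UNIV. u * q1 1 s a + v * q2 1 s a) = indicator {s1} s" if "0 < H" for s
    using assms that by (simp add: flows_def sum.distrib flip: sum_distrib_left distrib_right)
  moreover have "(\<Sum>a\<in>UNIV. u * q1 (Suc n) s' a + v * q2 (Suc n) s' a) =
      (\<Sum>s\<in>UNIV. \<Sum>a\<in>UNIV. (u * q1 n s a + v * q2 n s a) * pmf (p n s a) s')"
    if "0 < n" "n < H" for n s'
    using assms that
    by (simp add: flows_def sum.distrib distrib_right mult.assoc flip: sum_distrib_left)
  ultimately show ?thesis by (simp add: flows_def)
qed

lemma continuous_on_eval3 [continuous_intros]:
  "continuous_on S (\<lambda>q :: 'i \<Rightarrow> 'j \<Rightarrow> 'k \<Rightarrow> 'b::topological_space. q h s a)"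
proof -
  have "continuous_on S (\<lambda>q :: 'i \<Rightarrow> 'j \<Rightarrow> 'k \<Rightarrow> 'b. q h)"
    using continuous_on_id by (rule continuous_on_product_then_coordinatewise)
  then have "continuous_on S (\<lambda>q :: 'i \<Rightarrow> 'j \<Rightarrow> 'k \<Rightarrow> 'b. q h s)"
    by (rule continuous_on_product_then_coordinatewise)
  then show ?thesis
    by (rule continuous_on_product_then_coordinatewise)
qed

text \<open>Tychonoff's theorem; the index set may be infinite, as it is for the time index
  \<open>h\<close>.\<close>

lemma compact_Pi_UNIV:
  fixes S :: "'i \<Rightarrow> 'b::topological_space set"
  assumes "\<And>i. compact (S i)"
  shows "compact {f. \<forall>i. f i \<in> S i}"
proof -
  have "compactin (product_topology (\<lambda>i. euclidean) UNIV) (PiE UNIV S)"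
    using assms by (simp add: compactin_PiE compactin_euclidean_iff)
  moreover have "PiE UNIV S = {f. \<forall>i. f i \<in> S i}" by auto
  ultimately show ?thesis
    by (simp add: euclidean_product_topology compactin_euclidean_iff)
qed

lemma compact_flows: "compact (flows p s1 H)"
proof -
  let ?B = "{q :: nat \<Rightarrow> 'a \<Rightarrow> 'b \<Rightarrow> real. \<forall>h s a. q h s a \<in> (if h \<in> {1..H} then {0..1} else {0})}"
  \<comment> \<open>The box is a threefold nested product, so Tychonoff is applied once for each
    argument of \<open>q\<close>.\<close>
  have "compact {q :: nat \<Rightarrow> 'a \<Rightarrow> 'b \<Rightarrow> real.
      \<forall>h. q h \<in> {f. \<forall>s. f s \<in> {f. \<forall>a. f a \<in> (if h \<in> {1..H} then {0..1} else {0})}}}"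
    by (intro compact_Pi_UNIV) simp
  then have "compact ?B" by simp
  moreover have "closed (flows p s1 H)"
    unfolding flows_def
    by (intro closed_Collect_conj closed_Collect_all closed_Collect_imp open_Collect_const
        closed_Collect_eq continuous_intros) (auto intro!: closed_Collect_le continuous_intros closed_Collect_conj closed_Collect_eq)
  moreover have "flows p s1 H \<subseteq> ?B" by (auto simp: flows_def)
  ultimately show ?thesis
    using compact_Int_closed[of ?B "flows p s1 H"] by (simp add: Int_absorb1)
qed

section \<open>Lagrange multipliers from a separating hyperplane\<close>

text \<open>Convexity is asked of the image rather than of \<open>F\<close>, since the separation
  takes place in the finite-dimensional space of values, where disjoint nonempty convex sets can be
  separated without closedness.\<close>

lemma Lagrangian_multiplier_exists:
  fixes f :: "'q \<Rightarrow> real" and c :: "'q \<Rightarrow> real ^ 'm::finite"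
  assumes conv: "convex ((\<lambda>q. (f q, c q)) ` F)"
    and slater: "q0 \<in> F" "\<And>i. \<alpha> $ i < c q0 $ i"
    and bound: "\<And>q. q \<in> F \<Longrightarrow> (\<And>i. \<alpha> $ i \<le> c q $ i) \<Longrightarrow> f q \<le> M"
  shows "\<exists>l\<in>nonneg_vecs. \<forall>q\<in>F. f q + l \<bullet> (c q - \<alpha>) \<le> M"
proof -
  let ?W = "(\<lambda>q. (f q, c q)) ` F"
  let ?B = "{M<..} \<times> {y :: real ^ 'm. \<forall>i. \<alpha> $ i \<le> y $ i}"
  have "convex {y :: real ^ 'm. \<forall>i. \<alpha> $ i \<le> y $ i}"
    by (rule convex_box_cart) (simp flip: atLeast_def)
  then have "convex ?B" by (intro convex_Times) auto
  moreover have "?W \<noteq> {}" using slater by blast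
  moreover have "?B \<noteq> {}"
  proof -
    have "(M + 1, \<alpha>) \<in> ?B" by simp
    then show ?thesis by (metis empty_iff)
  qed
  moreover have "?W \<inter> ?B = {}" using bound by force
  ultimately have "\<exists>w b. w \<noteq> 0 \<and> (\<forall>x\<in>?W. w \<bullet> x \<le> b) \<and> (\<forall>x\<in>?B. b \<le> w \<bullet> x)"
    by (rule separating_hyperplane_sets[OF conv])
  then obtain w b where w: "w \<noteq> 0" "\<forall>x\<in>?W. w \<bullet> x \<le> b" "\<forall>x\<in>?B. b \<le> w \<bullet> x"
    by (elim exE conjE)
  obtain \<mu> l where wl: "w = (\<mu>, l)" by (cases w)
  have upper: "\<mu> * f q + l \<bullet> c q \<le> b" if "q \<in> F" for q
    using bspec[OF w(2), of "(f q, c q)"] that by (simp add: wl)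
  have lower: "b \<le> \<mu> * x + l \<bullet> y" if "M < x" "\<And>i. \<alpha> $ i \<le> y $ i" for x y
    using bspec[OF w(3), of "(x, y)"] that by (simp add: wl)
  have "\<mu> \<ge> 0"
  proof (rule ccontr)
    assume neg: "\<not> \<mu> \<ge> 0"
    \<comment> \<open>\<open>t\<close> exceeds by 1 the gap between \<open>b\<close> and the
      functional at \<open>(M + 1, \<alpha>)\<close>. Raising the reward by
      \<open>t / - \<mu>\<close> stays in \<open>?B\<close> and lowers the functional by exactly
      \<open>t\<close>, hence below \<open>b\<close>.\<close>
    define t where "t = \<bar>\<mu> * (M + 1) + l \<bullet> \<alpha> - b\<bar> + 1"
    have "b \<le> \<mu> * (M + 1 + t / - \<mu>) + l \<bullet> \<alpha>"
      using neg by (intro lower) (auto simp: t_def add_pos_nonneg divide_nonneg_neg)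
    also have "\<dots> = \<mu> * (M + 1) + l \<bullet> \<alpha> - t" using neg by (simp add: field_simps)
    finally show False by (simp add: t_def)
  qed
  have l: "l $ i \<ge> 0" for i
  proof (rule ccontr)
    assume neg: "\<not> l $ i \<ge> 0"
    \<comment> \<open>The same choice of \<open>t\<close>, now moving along constraint coordinate
      \<open>i\<close>.\<close>
    define t where "t = \<bar>\<mu> * (M + 1) + l \<bullet> \<alpha> - b\<bar> + 1"
    have "b \<le> \<mu> * (M + 1) + l \<bullet> (\<alpha> + axis i (t / - l $ i))"
      using neg by (intro lower) (auto simp: t_def axis_def divide_nonneg_neg)
    also have "\<dots> = \<mu> * (M + 1) + l \<bullet> \<alpha> - t"
      using neg by (simp add: inner_add_right inner_axis)
    finally show False by (simp add: t_def)
  qed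
  \<comment> \<open>\<open>?B\<close> excludes reward \<open>M\<close> itself, so this bound is a
    limit. The denominator \<open>\<mu> + 1\<close> below keeps the division meaningful while
    \<open>\<mu> = 0\<close> is still possible.\<close>
  have M: "b \<le> \<mu> * M + l \<bullet> \<alpha>"
  proof (rule field_le_epsilon)
    fix e :: real assume "e > 0"
    have "b \<le> \<mu> * (M + e / (\<mu> + 1)) + l \<bullet> \<alpha>"
      using \<open>\<mu> \<ge> 0\<close> \<open>e > 0\<close> by (intro lower) auto
    also have "\<mu> * (M + e / (\<mu> + 1)) \<le> \<mu> * M + e"
      using \<open>\<mu> \<ge> 0\<close> \<open>e > 0\<close> by (simp add: field_simps)
    finally show "b \<le> \<mu> * M + l \<bullet> \<alpha> + e" by simp
  qed
  have "\<mu> \<noteq> 0"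
  proof
    \<comment> \<open>Then \<open>l\<close> is nonzero and nonnegative, so strict slackness of
      \<open>q0\<close> gives \<open>l \<bullet> \<alpha> < l \<bullet> c q0\<close>, whereas
      \<open>upper\<close> and \<open>M\<close> give the reverse inequality.\<close>
    assume \<mu>: "\<mu> = 0"
    with w(1) wl have "l \<noteq> 0" by (auto simp: zero_prod_def)
    then obtain i where "l $ i \<noteq> 0" by (auto simp: vec_eq_iff)
    with l have "l $ i > 0" by (metis order_le_less)
    then have "0 < (\<Sum>i\<in>UNIV. l $ i * (c q0 $ i - \<alpha> $ i))"
      using slater l by (intro sum_pos2[of _ i]) (auto intro!: mult_nonneg_nonneg simp: less_imp_le)
    also have "\<dots> = l \<bullet> c q0 - l \<bullet> \<alpha>"
      by (simp add: inner_vec_def right_diff_distrib sum_subtractf)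
    finally show False using upper[OF slater(1)] M \<mu> by simp
  qed
  with \<open>\<mu> \<ge> 0\<close> have pos: "\<mu> > 0" by simp
  show ?thesis
  proof (intro bexI ballI)
    show "(1 / \<mu>) *\<^sub>R l \<in> nonneg_vecs" using pos l by (simp add: nonneg_vecs_def)
    fix q assume "q \<in> F"
    with upper M have "\<mu> * f q + l \<bullet> c q \<le> \<mu> * M + l \<bullet> \<alpha>" by (meson order_trans)
    then show "f q + (1 / \<mu>) *\<^sub>R l \<bullet> (c q - \<alpha>) \<le> M"
      using pos by (simp add: inner_diff_right field_simps)
  qed
qed

section \<open>Compactness and convexity of the optimistic feasible set\<close>

lemma continuous_on_pairing [continuous_intros]: "continuous_on S (pairing H v)"
  unfolding pairing_def by (intro continuous_intros)

lemma continuous_on_Lagrangian: "continuous_on S (\<lambda>q. Lagrangian H r g \<alpha> q l)"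
  unfolding Lagrangian_def constraint_vec_def inner_vec_def by (auto intro!: continuous_intros)

lemma pairing_combination:
  "pairing H v (\<lambda>h s a. x * q1 h s a + y * q2 h s a) = x * pairing H v q1 + y * pairing H v q2"
  by (simp add: pairing_def sum_distrib_left distrib_left sum.distrib mult.left_commute[of x]
      mult.left_commute[of y])

lemma compact_F_opt: "compact (F_opt p s1 H g \<alpha>_low)"
proof -
  have "F_opt p s1 H g \<alpha>_low = flows p s1 H \<inter> {q. \<forall>i. \<alpha>_low $ i \<le> pairing H (g i) q}"
    by (auto simp: F_opt_def occupancies_eq_flows)
  moreover have "closed {q. \<forall>i. \<alpha>_low $ i \<le> pairing H (g i) q}"
    by (intro closed_Collect_all closed_Collect_le continuous_intros)
  ultimately show ?thesis
    using compact_flows[of p s1 H] by (simp only: compact_Int_closed)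
qed

text \<open>All values are linear in \<open>q\<close>, so the image of a pointwise combination of
  flows is the combination of the images; weights summing to 1 preserve the optimistic
  thresholds.\<close>

lemma convex_value_image:
  "convex ((\<lambda>q. (pairing H r q, constraint_vec H g q)) ` F_opt p s1 H g \<alpha>_low)"
proof (rule convexI; elim imageE; clarsimp)
  fix x y :: real and q1 q2
  assume xy: "0 \<le> x" "0 \<le> y" "x + y = 1"
    and q: "q1 \<in> F_opt p s1 H g \<alpha>_low" "q2 \<in> F_opt p s1 H g \<alpha>_low"
  let ?q = "\<lambda>h s a. x * q1 h s a + y * q2 h s a"
  have "?q \<in> occupancies p s1 H"
    using q xy by (simp add: F_opt_def occupancies_eq_flows flows_convex)
  moreover have "\<alpha>_low $ i \<le> pairing H (g i) ?q" for i
  proof -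
    have "\<alpha>_low $ i = x * \<alpha>_low $ i + y * \<alpha>_low $ i"
      using xy by (simp flip: distrib_right)
    also have "\<dots> \<le> pairing H (g i) ?q"
      unfolding pairing_combination
      using q xy by (intro add_mono mult_left_mono) (auto simp: F_opt_def)
    finally show ?thesis .
  qed
  ultimately have "?q \<in> F_opt p s1 H g \<alpha>_low" by (simp add: F_opt_def)
  moreover have "constraint_vec H g ?q = x *\<^sub>R constraint_vec H g q1 + y *\<^sub>R constraint_vec H g q2"
    by (simp add: constraint_vec_def vec_eq_iff pairing_combination)
  ultimately show "(x * pairing H r q1 + y * pairing H r q2,
      x *\<^sub>R constraint_vec H g q1 + y *\<^sub>R constraint_vec H g q2)
    \<in> (\<lambda>q. (pairing H r q, constraint_vec H g q)) ` F_opt p s1 H g \<alpha>_low"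
    by (intro image_eqI[of _ _ ?q]) (simp_all add: pairing_combination)
qed

section \<open>Strong duality and attainment\<close>

text \<open>Extended reals accommodate the inner minimum \<open>-\<infinity>\<close> at infeasible
  \<open>q\<close>. The conjuncts after the equation certify attainment, so that its infima and
  suprema are genuine minima and maxima.\<close>

theorem lemma2:
  fixes p :: "('s::finite, 'a::finite) kernel"
    and s1 :: 's
    and H :: nat
    and r :: "('s, 'a) hsa"
    and g :: "'m::finite \<Rightarrow> ('s, 'a) hsa"
    and \<alpha> \<alpha>_low \<xi> :: "real ^ 'm"
    and \<pi>0 :: "('s, 'a) policy"
  assumes "\<And>h s a. h \<in> {1..H} \<Longrightarrow> r h s a \<in> {0..1}"
    and "\<And>i h s a. h \<in> {1..H} \<Longrightarrow> g i h s a \<in> {0..1}"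
    and "\<And>i. \<alpha> $ i \<in> {0..real H}"
    and "\<And>i. \<alpha>_low $ i \<le> \<alpha> $ i"
    and "\<And>i. \<xi> $ i > 0"
    and "\<And>i. policy_value p s1 H (g i) \<pi>0 \<ge> \<alpha> $ i + \<xi> $ i"
  defines "F \<equiv> F_opt p s1 H g \<alpha>_low"
    and "L \<equiv> Lagrangian H r g \<alpha>"
  defines "maxL \<equiv> (\<lambda>l. SUP q\<in>F. ereal (L q l))"
    and "minL \<equiv> (\<lambda>q. INF l\<in>nonneg_vecs. ereal (L q l))"
  shows "(INF l\<in>nonneg_vecs. maxL l) = (SUP q\<in>F. minL q)
    \<and> (\<forall>l\<in>nonneg_vecs. \<exists>q. is_arg_max (\<lambda>q. L q l) (\<lambda>q. q \<in> F) q)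
    \<and> (\<exists>l. is_arg_min maxL (\<lambda>l. l \<in> nonneg_vecs) l)
    \<and> (\<forall>q\<in>F. if \<forall>i. constraint_vec H g q $ i \<ge> \<alpha> $ i
              then \<exists>l. is_arg_min (L q) (\<lambda>l. l \<in> nonneg_vecs) l
              else minL q = -\<infinity>)
    \<and> (\<exists>q. is_arg_max minL (\<lambda>q. q \<in> F) q)"
proof -
  let ?f = "pairing H r" and ?c = "constraint_vec H g"
  define feasible where "feasible = (\<lambda>q. \<forall>i. \<alpha> $ i \<le> ?c q $ i)"
  have L: "L q l = ?f q + l \<bullet> (?c q - \<alpha>)" for q l
    by (simp add: L_def Lagrangian_def)
  have zero: "0 \<in> nonneg_vecs" by (simp add: nonneg_vecs_def)
  define q0 where "q0 = occupancy p s1 H \<pi>0"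
  have q0_slater: "\<alpha> $ i < ?c q0 $ i" for i
    using assms(5,6)[of i] by (simp add: q0_def constraint_vec_def policy_value_eq_pairing)
  have q0_F: "q0 \<in> F"
  proof -
    have "\<alpha>_low $ i \<le> pairing H (g i) q0" for i
      using q0_slater[of i] assms(4)[of i] by (simp add: constraint_vec_def)
    then show ?thesis by (simp add: F_def F_opt_def q0_def occupancies_def)
  qed
  have compact_F: "compact F" unfolding F_def by (rule compact_F_opt)
  have compact_feasible: "compact (F \<inter> {q. feasible q})"
  proof (rule compact_Int_closed[OF compact_F])
    show "closed {q. feasible q}"
      unfolding feasible_def constraint_vec_def vec_lambda_beta
      by (intro closed_Collect_all closed_Collect_le continuous_intros)
  qed
  have "F \<inter> {q. feasible q} \<noteq> {}"
    using q0_F q0_slater by (auto simp: feasible_def intro: less_imp_le)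
  \<comment> \<open>\<open>?f qs\<close>, the optimum under the true thresholds, is the common value
    of both sides.\<close>
  then obtain qs where qs: "qs \<in> F" "feasible qs"
    and qs_max: "\<And>q. q \<in> F \<Longrightarrow> feasible q \<Longrightarrow> ?f q \<le> ?f qs"
    using continuous_attains_sup[OF compact_feasible _ continuous_on_pairing[of _ H r]] by auto
  \<comment> \<open>\<open>ls\<close> bounds the dual function by the primal optimum, which closes
    the duality gap.\<close>
  obtain ls where ls: "ls \<in> nonneg_vecs" "\<And>q. q \<in> F \<Longrightarrow> L q ls \<le> ?f qs"
    using Lagrangian_multiplier_exists[of ?f ?c F q0 \<alpha> "?f qs"]
      convex_value_image q0_F q0_slater qs_max
    unfolding L F_def feasible_def by blast

  \<comment> \<open>Nonnegative multipliers meet nonnegative slacks, so the penalty term only adds;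
    equality at \<open>l = 0\<close> makes 0 the inner minimiser.\<close>
  have feasible_ge: "?f q \<le> L q l" if "feasible q" "l \<in> nonneg_vecs" for q l
    using that unfolding L feasible_def nonneg_vecs_def inner_vec_def
    by (auto intro!: sum_nonneg)
  have feasible_minL: "minL q = ?f q" if "feasible q" for q
    unfolding minL_def
  proof (rule INF_eqI)
    show "ereal (?f q) \<le> ereal (L q l)" if "l \<in> nonneg_vecs" for l
      using feasible_ge \<open>feasible q\<close> that by simp
    show "y \<le> ereal (?f q)" if "\<And>l. l \<in> nonneg_vecs \<Longrightarrow> y \<le> ereal (L q l)" for y
      using that[OF zero] by (simp add: L)
  qed
  have infeasible_minL: "minL q = -\<infinity>" if "\<not> feasible q" for q
  proof (rule ereal_bot)
    obtain i where i: "?c q $ i < \<alpha> $ i" using \<open>\<not> feasible q\<close> by (auto simp: feasible_def not_le)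
    fix B :: real
    \<comment> \<open>Weight \<open>t\<close> on the violated constraint \<open>i\<close> lowers the
      Lagrangian by exactly \<open>\<bar>?f q - B\<bar>\<close>, enough to reach any real
      \<open>B\<close>.\<close>
    define t where "t = \<bar>?f q - B\<bar> / (\<alpha> $ i - ?c q $ i)"
    have "t \<ge> 0" using i by (simp add: t_def)
    then have "axis i t \<in> nonneg_vecs" by (simp add: nonneg_vecs_def axis_def)
    then have "minL q \<le> L q (axis i t)" unfolding minL_def by (rule INF_lower)
    also have "L q (axis i t) = ?f q - t * (\<alpha> $ i - ?c q $ i)"
      by (simp add: L inner_axis' algebra_simps)
    also have "\<dots> = ?f q - \<bar>?f q - B\<bar>" using i by (simp add: t_def)
    also have "ereal \<dots> \<le> B" by simp
    finally show "minL q \<le> B" by simp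
  qed
  \<comment> \<open>Weak duality, tested at the feasible point \<open>qs\<close>.\<close>
  have maxL_ge: "?f qs \<le> maxL l" if "l \<in> nonneg_vecs" for l
  proof -
    have "ereal (?f qs) \<le> L qs l" using feasible_ge qs that by simp
    also have "\<dots> \<le> maxL l" unfolding maxL_def using qs(1) by (rule SUP_upper)
    finally show ?thesis .
  qed
  have maxL_ls: "maxL ls = ?f qs"
    using ls by (intro antisym maxL_ge) (auto simp: maxL_def intro: SUP_least)
  have minL_le: "minL q \<le> ?f qs" if "q \<in> F" for q
    using that qs_max by (cases "feasible q") (auto simp: feasible_minL infeasible_minL)
  have minL_qs: "minL qs = ?f qs" using feasible_minL qs by simp
  have "(INF l\<in>nonneg_vecs. maxL l) = ?f qs"
    using ls(1) maxL_ge maxL_ls by (intro antisym INF_greatest) (auto intro: INF_lower2)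
  moreover have "(SUP q\<in>F. minL q) = ?f qs"
    using qs(1) minL_le minL_qs by (intro antisym SUP_least) (auto intro: SUP_upper2)
  moreover have "\<exists>q. is_arg_max (\<lambda>q. L q l) (\<lambda>q. q \<in> F) q" for l
    using continuous_attains_sup[OF compact_F _ continuous_on_Lagrangian[of F H r g \<alpha> l]] q0_F
    by (auto simp: is_arg_max_linorder L_def)
  moreover have "is_arg_min maxL (\<lambda>l. l \<in> nonneg_vecs) ls"
    using ls(1) maxL_ge by (simp add: is_arg_min_linorder maxL_ls)
  moreover have "is_arg_min (L q) (\<lambda>l. l \<in> nonneg_vecs) 0" if "feasible q" for q
    using zero feasible_ge[OF that] by (simp add: is_arg_min_linorder L)
  moreover have "is_arg_max minL (\<lambda>q. q \<in> F) qs"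
    using qs(1) minL_le by (simp add: is_arg_max_linorder minL_qs)
  ultimately show ?thesis
    using infeasible_minL unfolding feasible_def by auto
qed

end
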